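(* For every prime $p$ and every integer $n \ge 2$, the equation $$x_1 + p x_2 + \cdots + p^{n-2} x_{n-1} - p^{n-1} x_n = 0, \quad\text{i.e.}\quad \sum_{i=1}^{n-1} p^{i-1} x_i = p^{n-1} x_n,$$ in the $n$ variables $x_1, \dots, x_n$ is $(n-1)$-regular but not $n$-regular.
   Context: $\mathbb{N}$ denotes the set of positive integers. For a positive integer $r$, an $r$-coloring of the positive integers is any function $C : \mathbb{N} \to \{1, \dots, r\}$. A linear homogeneous equation $a_1 x_1 + \cdots + a_n x_n = 0$ (with all $a_i$ nonzero integers) is called $r$-regular if for every $r$-coloring $C$ of the positive integers there is a monochromatic solution, i.e. positive integers $x_1, \dots, x_n$ (not necessarily distinct) satisfying the equation with $C(x_1) = \cdots = C(x_n)$. *)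

theory Defs
  imports "HOL-Computational_Algebra.Primes"
begin

(* The positive integers are the elements of {1..} in type nat; the value of a
   coloring at 0 is unconstrained and never used. *)
definition is_coloring :: "nat \<Rightarrow> (nat \<Rightarrow> nat) \<Rightarrow> bool" where
  "is_coloring r C \<longleftrightarrow> (\<forall>x\<ge>1. C x \<in> {1..r})"

(* The equation a 1 * x 1 + ... + a n * x n = 0 is given by n and its integer
   coefficients a 1, ..., a n; values of a and x outside {1..n} are irrelevant. *)
definition is_solution :: "nat \<Rightarrow> (nat \<Rightarrow> int) \<Rightarrow> (nat \<Rightarrow> nat) \<Rightarrow> bool" where
  "is_solution n a x \<longleftrightarrow>
     (\<forall>i\<in>{1..n}. x i \<ge> 1) \<and> (\<Sum>i=1..n. a i * int (x i)) = 0"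

definition monochromatic :: "nat \<Rightarrow> (nat \<Rightarrow> nat) \<Rightarrow> (nat \<Rightarrow> nat) \<Rightarrow> bool" where
  "monochromatic n C x \<longleftrightarrow> (\<forall>i\<in>{1..n}. \<forall>j\<in>{1..n}. C (x i) = C (x j))"

definition regular :: "nat \<Rightarrow> nat \<Rightarrow> (nat \<Rightarrow> int) \<Rightarrow> bool" where
  "regular r n a \<longleftrightarrow>
     (\<forall>C. is_coloring r C \<longrightarrow> (\<exists>x. is_solution n a x \<and> monochromatic n C x))"

definition power_coeff :: "nat \<Rightarrow> nat \<Rightarrow> nat \<Rightarrow> int" where
  "power_coeff p n i = (if i = n then - (int p ^ (n - 1)) else int p ^ (i - 1))"

end

theory Submission
  imports Defs
begin

text \<open>
  Colour \<open>x\<close> by its \<open>p\<close>-adic valuation modulo \<open>n\<close>. In a monochromatic solution the valuations of the \<open>n\<close>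
  terms are pairwise distinct modulo \<open>n\<close>, so the term of least valuation cannot be cancelled.

  Conversely, given an \<open>(n - 1)\<close>-colouring \<open>C\<close>, apply Brauer's theorem to the colouring by the vectors
  \<open>(C x, C (p x), ..., C (p^(n-1) x))\<close>: all \<open>a + i d\<close> with \<open>i \<le> L\<close> and also \<open>p^(n-1) d\<close> receive the
  same vector. Two of its \<open>n\<close> entries agree, say those at \<open>u < v\<close>. With \<open>k = n - (v - u)\<close>, take
  \<open>x\<^sub>k = p^v a\<close>, \<open>x\<^sub>n = p^u (a + m d)\<close> and \<open>x\<^sub>i = p^u p^(n-1) d\<close> for the other \<open>i\<close>. The
  multiples of \<open>a\<close> cancel, and \<open>m\<close> is chosen such that the multiples of \<open>d\<close> do as well.
\<close>

section \<open>Van der Waerden's theorem\<close>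

text \<open>Lets blocks of colours serve as colours in \<open>vdW_focus\<close>: an injection of
  \<open>S\<close> into the naturals turns them into numbers.\<close>

lemma vdW_transfer:
  fixes S :: "'a set"
  assumes vdW: "\<And>r. \<exists>N. \<forall>C::nat \<Rightarrow> nat. (\<forall>x. C x < r) \<longrightarrow>
      (\<exists>a\<le>N. \<exists>d\<le>N. 0 < d \<and> (\<forall>i<k. C (a + i * d) = C a))"
    and "finite S"
  shows "\<exists>N. \<forall>C. (\<forall>x. C x \<in> S) \<longrightarrow>
      (\<exists>a\<le>N. \<exists>d\<le>N. 0 < d \<and> (\<forall>i<k. C (a + i * d) = C a))"
proof -
  obtain h :: "'a \<Rightarrow> nat" and r where h: "h ` S = {i. i < r}" "inj_on h S"
    using finite_imp_inj_to_nat_seg[OF \<open>finite S\<close>] by blast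
  obtain N where N: "\<forall>C::nat \<Rightarrow> nat. (\<forall>x. C x < r) \<longrightarrow>
      (\<exists>a\<le>N. \<exists>d\<le>N. 0 < d \<and> (\<forall>i<k. C (a + i * d) = C a))"
    using vdW by blast
  have "\<exists>a\<le>N. \<exists>d\<le>N. 0 < d \<and> (\<forall>i<k. C (a + i * d) = C a)" if C: "\<forall>x. C x \<in> S" for C
  proof -
    have "\<forall>x. (h \<circ> C) x < r" using h(1) C by auto
    then obtain a d where ad: "a \<le> N" "d \<le> N" "0 < d" "\<forall>i<k. (h \<circ> C) (a + i * d) = (h \<circ> C) a"
      using N by blast
    have "\<forall>i<k. C (a + i * d) = C a"
      using ad(4) C h(2) by (auto simp: inj_on_def)
    with ad show ?thesis by blast
  qed
  then show ?thesis by blast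
qed

text \<open>The set \<open>K\<close> collects the colours of progressions of length \<open>k\<close>, all of which are continued
  by the same number \<open>f\<close>. Once \<open>K\<close> contains every colour, \<open>f\<close> extends one of them.\<close>

lemma vdW_focus:
  assumes vdW: "\<And>r. \<exists>N. \<forall>C::nat \<Rightarrow> nat. (\<forall>x. C x < r) \<longrightarrow>
      (\<exists>a\<le>N. \<exists>d\<le>N. 0 < d \<and> (\<forall>i<k. C (a + i * d) = C a))"
  shows "\<exists>N. \<forall>C::nat \<Rightarrow> nat. (\<forall>x. C x < r) \<longrightarrow>
      (\<exists>a\<le>N. \<exists>d\<le>N. 0 < d \<and> (\<forall>i<Suc k. C (a + i * d) = C a)) \<or>
      (\<exists>f\<le>N. \<exists>K\<subseteq>{..<r}. card K = s \<and>
         (\<forall>c\<in>K. \<exists>a. \<exists>d\<le>N. 0 < d \<and> a + k * d = f \<and> (\<forall>i<k. C (a + i * d) = c)))"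
proof (induction s)
  case 0
  show ?case
    by (intro exI[of _ 0] allI impI disjI2 conjI exI[of _ "{}"]) auto
next
  case (Suc s)
  then obtain N where N: "\<And>C::nat \<Rightarrow> nat. (\<forall>x. C x < r) \<Longrightarrow>
      (\<exists>a\<le>N. \<exists>d\<le>N. 0 < d \<and> (\<forall>i<Suc k. C (a + i * d) = C a)) \<or>
      (\<exists>f\<le>N. \<exists>K\<subseteq>{..<r}. card K = s \<and>
         (\<forall>c\<in>K. \<exists>a. \<exists>d\<le>N. 0 < d \<and> a + k * d = f \<and> (\<forall>i<k. C (a + i * d) = c)))"
    by blast
  \<comment> \<open>A block has positions \<open>0..N\<close>, so it contains the focus
    \<open>f \<le> N\<close> and the progressions leading to it.\<close>
  define n where "n = Suc N"
  define S where "S = {xs. set xs \<subseteq> {..<r} \<and> length xs = n}"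
  have "finite S" unfolding S_def by (rule finite_lists_length_eq) simp
  from vdW_transfer[OF vdW this] obtain Q where Q: "\<And>C. (\<forall>x. C x \<in> S) \<Longrightarrow>
      (\<exists>a\<le>Q. \<exists>d\<le>Q. 0 < d \<and> (\<forall>i<k. C (a + i * d) = C a))"
    by blast
  \<comment> \<open>The first two summands bound the new focus \<open>F\<close>, the last two the
    new differences \<open>n * D + d\<close>.\<close>
  define N' where "N' = n * (Q + k * Q) + n + n * Q"
  show ?case
  proof (intro exI[of _ N'] allI impI)
    fix C :: "nat \<Rightarrow> nat"
    assume C: "\<forall>x. C x < r"
    define B where "B y = map (\<lambda>x. C (n * y + x)) [0..<n]" for y
    have "\<forall>y. B y \<in> S" using C by (auto simp: B_def S_def)
    from Q[OF this] obtain b D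
      where bD: "b \<le> Q" "D \<le> Q" "0 < D" "\<And>i. i < k \<Longrightarrow> B (b + i * D) = B b"
      by blast
    have B: "C (n * (b + i * D) + x) = C (n * b + x)" if "i < k" "x \<le> N" for i x
    proof -
      have "B (b + i * D) ! x = B b ! x" using bD(4) that by simp
      then show ?thesis using that by (simp add: B_def n_def del: upt_Suc)
    qed
    define C' where "C' x = C (n * b + x)" for x
    have C': "\<forall>x. C' x < r" using C by (simp add: C'_def)
    have nb: "n * b \<le> n * Q" "n * D \<le> n * Q" using bD by auto
    have kD: "n * (b + k * D) \<le> n * (Q + k * Q)"
      using bD by (intro mult_le_mono2 add_mono) auto
    let ?AP = "\<exists>a\<le>N'. \<exists>d\<le>N'. 0 < d \<and> (\<forall>i<Suc k. C (a + i * d) = C a)"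
    have AP: ?AP if ad: "a \<le> N" "d \<le> N" "0 < d" "\<forall>i<Suc k. C' (a + i * d) = C' a" for a d
    proof -
      have "n * b + a \<le> N'" "d \<le> N'" using ad nb by (auto simp: N'_def n_def)
      moreover have "\<forall>i<Suc k. C (n * b + a + i * d) = C (n * b + a)"
        using ad(4) by (simp add: C'_def add.assoc)
      ultimately show ?thesis using ad(3) by blast
    qed
    from N[OF C']
    show "?AP \<or> (\<exists>f\<le>N'. \<exists>K\<subseteq>{..<r}. card K = Suc s \<and>
         (\<forall>c\<in>K. \<exists>a. \<exists>d\<le>N'. 0 < d \<and> a + k * d = f \<and> (\<forall>i<k. C (a + i * d) = c)))"
    proof (elim disjE)
      assume "\<exists>a\<le>N. \<exists>d\<le>N. 0 < d \<and> (\<forall>i<Suc k. C' (a + i * d) = C' a)"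
      then show ?thesis using AP by blast
    next
      assume "\<exists>f\<le>N. \<exists>K\<subseteq>{..<r}. card K = s \<and>
         (\<forall>c\<in>K. \<exists>a. \<exists>d\<le>N. 0 < d \<and> a + k * d = f \<and> (\<forall>i<k. C' (a + i * d) = c))"
      then obtain f K where f: "f \<le> N" and K: "K \<subseteq> {..<r}" "card K = s"
        and foc: "\<And>c. c \<in> K \<Longrightarrow>
          \<exists>a. \<exists>d\<le>N. 0 < d \<and> a + k * d = f \<and> (\<forall>i<k. C' (a + i * d) = c)"
        by blast
      show ?thesis
      proof (cases "C' f \<in> K")
        case True
        from foc[OF this] obtain a d
          where ad: "d \<le> N" "0 < d" "a + k * d = f" "\<forall>i<k. C' (a + i * d) = C' f"
          by blast
        have eq: "C' (a + i * d) = C' f" if "i < Suc k" for i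
          using ad(3,4) that by (cases "i = k") auto
        have "\<forall>i<Suc k. C' (a + i * d) = C' a"
          using eq eq[of 0] by simp
        moreover have "a \<le> N" using ad f by simp
        ultimately show ?thesis using AP ad by blast
      next
        case False
        \<comment> \<open>The focus moves to position \<open>f\<close> of block
          \<open>b + k * D\<close>. Progressions towards \<open>f\<close> in block \<open>b\<close>
          reach it once \<open>n * D\<close> is added to their difference; the new colour
          \<open>C' f\<close> comes from position \<open>f\<close> of the blocks
          \<open>b + i * D\<close>.\<close>
        define F where "F = n * (b + k * D) + f"
        have "finite K" using K finite_subset by blast
        have "\<exists>a. \<exists>d\<le>N'. 0 < d \<and> a + k * d = F \<and> (\<forall>i<k. C (a + i * d) = c)"
          if "c \<in> insert (C' f) K" for c
        proof (cases "c \<in> K")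
          case True
          from foc[OF this] obtain a d
            where ad: "d \<le> N" "0 < d" "a + k * d = f" "\<And>i. i < k \<Longrightarrow> C' (a + i * d) = c"
            by blast
          have "C (n * b + a + i * (n * D + d)) = c" if "i < k" for i
          proof -
            have "i * d \<le> k * d" using that by simp
            then have "a + i * d \<le> N" using ad(3) f by linarith
            from B[OF that this] ad(4)[OF that] show ?thesis
              by (simp add: C'_def algebra_simps)
          qed
          moreover have "n * D + d \<le> N'" using nb ad(1) by (simp add: N'_def n_def)
          moreover have "n * b + a + k * (n * D + d) = F"
            using ad(3) by (auto simp: F_def algebra_simps)
          ultimately show ?thesis using ad(2) by (metis add_gr_0)
        next
          case False
          then have c: "c = C' f" using that by simp
          have "C (n * b + f + i * (n * D)) = c" if "i < k" for i
            using B[OF that f] by (simp add: C'_def c algebra_simps)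
          moreover have "n * D \<le> N'" "0 < n * D" using nb bD(3) by (auto simp: N'_def n_def)
          moreover have "n * b + f + k * (n * D) = F" by (simp add: F_def algebra_simps)
          ultimately show ?thesis by blast
        qed
        moreover have "insert (C' f) K \<subseteq> {..<r}" "card (insert (C' f) K) = Suc s"
          using K C' False \<open>finite K\<close> by auto
        moreover have "F \<le> N'" using kD f by (simp add: F_def N'_def n_def)
        ultimately show ?thesis by blast
      qed
    qed
  qed
qed

text \<open>That \<open>N\<close> is independent of the colouring carries the induction through
  \<open>vdW_focus\<close> and later yields \<open>M\<close> in \<open>Brauer_aux\<close>.\<close>

theorem van_der_Waerden:
  "\<exists>N. \<forall>C::nat \<Rightarrow> nat. (\<forall>x. C x < r) \<longrightarrow>
      (\<exists>a\<le>N. \<exists>d\<le>N. 0 < d \<and> (\<forall>i<k. C (a + i * d) = C a))"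
proof (induction k arbitrary: r)
  case 0
  show ?case by (intro exI[of _ 1]) auto
next
  case (Suc k)
  obtain N where N: "\<And>C::nat \<Rightarrow> nat. (\<forall>x. C x < r) \<Longrightarrow>
      (\<exists>a\<le>N. \<exists>d\<le>N. 0 < d \<and> (\<forall>i<Suc k. C (a + i * d) = C a)) \<or>
      (\<exists>f\<le>N. \<exists>K\<subseteq>{..<r}. card K = r \<and>
         (\<forall>c\<in>K. \<exists>a. \<exists>d\<le>N. 0 < d \<and> a + k * d = f \<and> (\<forall>i<k. C (a + i * d) = c)))"
    using vdW_focus[OF Suc, of r r] by blast
  have "\<exists>a\<le>N. \<exists>d\<le>N. 0 < d \<and> (\<forall>i<Suc k. C (a + i * d) = C a)"
    if C: "\<forall>x. C x < r" for C :: "nat \<Rightarrow> nat"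
    using N[OF C]
  proof (elim disjE)
    assume "\<exists>f\<le>N. \<exists>K\<subseteq>{..<r}. card K = r \<and>
         (\<forall>c\<in>K. \<exists>a. \<exists>d\<le>N. 0 < d \<and> a + k * d = f \<and> (\<forall>i<k. C (a + i * d) = c))"
    then obtain f K where f: "f \<le> N" and K: "K \<subseteq> {..<r}" "card K = r"
      and foc: "\<And>c. c \<in> K \<Longrightarrow>
        \<exists>a. \<exists>d\<le>N. 0 < d \<and> a + k * d = f \<and> (\<forall>i<k. C (a + i * d) = c)"
      by blast
    have "K = {..<r}" using K by (simp add: card_subset_eq)
    then obtain a d
      where ad: "d \<le> N" "0 < d" "a + k * d = f" "\<forall>i<k. C (a + i * d) = C f"
      using foc C by blast
    have eq: "C (a + i * d) = C f" if "i < Suc k" for i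
      using ad(3,4) that by (cases "i = k") auto
    have "\<forall>i<Suc k. C (a + i * d) = C a"
      using eq eq[of 0] by simp
    moreover have "a \<le> N" using ad f by simp
    ultimately show ?thesis using ad by blast
  qed
  then show ?case by blast
qed

section \<open>Brauer's theorem\<close>

text \<open>Induction on the number of colours used on \<open>{1..M}\<close>: a progression \<open>a + i d\<close> of colour \<open>q\<close> either
  yields the claim or forces \<open>q\<close> to be missing among the small multiples of \<open>c d\<close>.\<close>

lemma Brauer_aux:
  fixes c L r :: nat
  assumes "0 < c"
  shows "\<exists>M. \<forall>C K. (\<forall>x. C x < r) \<and> K \<subseteq> {..<r} \<and> card K = s \<and> (\<forall>x\<in>{1..M}. C x \<in> K) \<longrightarrow>
      (\<exists>a>0. \<exists>d>0. \<forall>i\<le>L. C (a + i * d) = C (c * d))"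
proof (induction s)
  case 0
  \<comment> \<open>\<open>M = 1\<close> suffices: the number 1 would need a colour from an empty
    \<open>K\<close>.\<close>
  have False if "K \<subseteq> {..<r}" "card K = 0" "\<forall>x\<in>{1..1}. C x \<in> K" for K and C :: "nat \<Rightarrow> nat"
    using that finite_subset[OF that(1)] by auto
  then show ?case by blast
next
  case (Suc s)
  then obtain m where m: "\<And>C K. \<forall>x. C x < r \<Longrightarrow> K \<subseteq> {..<r} \<Longrightarrow> card K = s \<Longrightarrow>
      \<forall>x\<in>{1..m}. C x \<in> K \<Longrightarrow> \<exists>a>0. \<exists>d>0. \<forall>i\<le>L. C (a + i * d) = C (c * d)"
    by blast
  \<comment> \<open>Length \<open>L * m + 1\<close> leaves room for \<open>L + 1\<close> terms with
    difference \<open>d * t\<close>, for every \<open>t \<le> m\<close>.\<close>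
  obtain N where N: "\<And>C::nat \<Rightarrow> nat. \<forall>x. C x < r \<Longrightarrow>
      \<exists>a\<le>N. \<exists>d\<le>N. 0 < d \<and> (\<forall>i<Suc (L * m). C (a + i * d) = C a)"
    using van_der_Waerden[of r "Suc (L * m)"] by blast
  \<comment> \<open>Large enough for \<open>Suc a\<close> and for all \<open>c * d * t\<close> with
    \<open>d \<le> N\<close> and \<open>t \<le> m\<close>.\<close>
  define M where "M = Suc N + c * N * m"
  have "\<exists>a>0. \<exists>d>0. \<forall>i\<le>L. C (a + i * d) = C (c * d)"
    if C: "\<forall>x. C x < r" and K: "K \<subseteq> {..<r}" "card K = Suc s" and CK: "\<forall>x\<in>{1..M}. C x \<in> K"
    for C :: "nat \<Rightarrow> nat" and K
  proof -
    \<comment> \<open>The shift makes the progression start at a positive number even if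
      \<open>a = 0\<close>.\<close>
    have "\<forall>x. (\<lambda>x. C (Suc x)) x < r" using C by simp
    from N[OF this] obtain a d where ad: "a \<le> N" "d \<le> N" "0 < d"
      "\<And>i. i < Suc (L * m) \<Longrightarrow> C (Suc (a + i * d)) = C (Suc a)"
      by blast
    have M: "c * d * t \<le> M" if "t \<le> m" for t
    proof -
      have "c * d * t \<le> c * N * m" using ad(2) that by (intro mult_le_mono) auto
      then show ?thesis unfolding M_def by linarith
    qed
    show ?thesis
    proof (cases "\<exists>t\<in>{1..m}. C (c * d * t) = C (Suc a)")
      case True
      then obtain t where t: "1 \<le> t" "t \<le> m" "C (c * d * t) = C (Suc a)" by auto
      have "C (Suc a + i * (d * t)) = C (c * (d * t))" if "i \<le> L" for i
      proof -
        have "i * t \<le> L * m" using that t by (intro mult_le_mono)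
        from ad(4)[of "i * t"] this t(3) show ?thesis by (simp add: algebra_simps)
      qed
      moreover have "0 < d * t" using ad t by simp
      ultimately show ?thesis by blast
    next
      case False
      \<comment> \<open>The induction hypothesis is applied to the colouring rescaled by
        \<open>c * d\<close>; multiplying the result by \<open>c * d\<close> gives one for
        \<open>C\<close>.\<close>
      have "\<exists>a'>0. \<exists>d'>0. \<forall>i\<le>L. (\<lambda>t. C (c * d * t)) (a' + i * d') = (\<lambda>t. C (c * d * t)) (c * d')"
      proof (rule m[of _ "K - {C (Suc a)}"])
        have "C (Suc a) \<in> K" using CK ad(1) by (simp add: M_def)
        then show "card (K - {C (Suc a)}) = s"
          using K finite_subset[OF K(1)] by simp
        show "\<forall>x\<in>{1..m}. C (c * d * x) \<in> K - {C (Suc a)}"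
          using False CK M ad(3) \<open>0 < c\<close> by (auto simp: Suc_le_eq)
      qed (use C K in auto)
      then obtain a' d' where a': "0 < a'" "0 < d'"
        "\<And>i. i \<le> L \<Longrightarrow> C (c * d * (a' + i * d')) = C (c * d * (c * d'))"
        by blast
      have "\<forall>i\<le>L. C (c * d * a' + i * (c * d * d')) = C (c * (c * d * d'))"
        using a'(3) by (simp add: algebra_simps)
      moreover have "0 < c * d * a'" "0 < c * d * d'" using a' ad(3) \<open>0 < c\<close> by auto
      ultimately show ?thesis by blast
    qed
  qed
  then show ?case by blast
qed

theorem Brauer:
  fixes C :: "nat \<Rightarrow> 'a" and c L :: nat
  assumes "finite (range C)" and "0 < c"
  obtains a d where "0 < a" "0 < d" "\<And>i. i \<le> L \<Longrightarrow> C (a + i * d) = C (c * d)"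
proof -
  obtain h :: "'a \<Rightarrow> nat" and r where h: "h ` range C = {i. i < r}" "inj_on h (range C)"
    using finite_imp_inj_to_nat_seg[OF assms(1)] by blast
  have hr: "\<forall>x. (h \<circ> C) x < r" using h(1) by auto
  \<comment> \<open>With \<open>s = r\<close> and \<open>K = {..<r}\<close> the condition on
    \<open>{1..M}\<close> holds automatically.\<close>
  from Brauer_aux[OF assms(2), of r r L]
  have "\<exists>a>0. \<exists>d>0. \<forall>i\<le>L. (h \<circ> C) (a + i * d) = (h \<circ> C) (c * d)"
    using hr by (metis card_lessThan order_refl lessThan_iff)
  then obtain a d where ad: "0 < a" "0 < d" "\<And>i. i \<le> L \<Longrightarrow> h (C (a + i * d)) = h (C (c * d))"
    by auto
  show thesis
    using ad(3) h(2) by (intro that[OF ad(1,2)]) (auto simp: inj_on_def)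
qed

section \<open>Regularity for \<open>n - 1\<close> colours\<close>

lemma regular_power_coeff:
  fixes p n :: nat
  assumes "0 < p" and "n \<ge> 2"
  shows "regular (n - 1) n (power_coeff p n)"
  unfolding regular_def
proof (intro allI impI)
  fix C assume C: "is_coloring (n - 1) C"
  \<comment> \<open>\<open>C 0\<close> is unconstrained, so the entries at 0 default to colour 1;
    this keeps the range of \<open>V\<close> finite.\<close>
  define V where "V x = map (\<lambda>j. if x = 0 then 1 else C (p ^ j * x)) [0..<n]" for x
  have "set (V x) \<subseteq> {1..n - 1}" "length (V x) = n" for x
  proof -
    have "C (p ^ j * x) \<in> {1..n - 1}" if "x \<noteq> 0" for j
    proof -
      have "1 \<le> p ^ j * x" using that assms by (simp add: Suc_le_eq)
      then show ?thesis using C unfolding is_coloring_def by blast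
    qed
    then show "set (V x) \<subseteq> {1..n - 1}" "length (V x) = n"
      using assms(2) by (auto simp: V_def)
  qed
  then have "range V \<subseteq> {xs. set xs \<subseteq> {1..n - 1} \<and> length xs = n}" by blast
  then have fin: "finite (range V)"
    by (rule finite_subset) (simp add: finite_lists_length_eq)
  \<comment> \<open>The sum of all positive coefficients bounds \<open>m\<close> before
    \<open>k\<close> is known.\<close>
  define L where "L = (\<Sum>i=1..n-1. p ^ (i - 1))"
  have "0 < p ^ (n - 1)" using assms by simp
  from Brauer[OF fin this, of L] obtain a d where ad: "0 < a" "0 < d"
    and V: "\<And>i. i \<le> L \<Longrightarrow> V (a + i * d) = V (p ^ (n - 1) * d)"
    by blast
  define f where "f j = C (p ^ j * a)" for j
  have V_nth: "V x ! j = C (p ^ j * x)" if "j < n" "0 < x" for x j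
    using that by (simp add: V_def)
  have Va: "V (a + i * d) = V a" if "i \<le> L" for i
    using V[of 0] V[OF that] by simp
  have colA: "C (p ^ j * (a + i * d)) = f j" if "i \<le> L" "j < n" for i j
    using V_nth[of j "a + i * d"] V_nth[of j a] Va[OF that(1)] that ad by (simp add: f_def)
  have colD: "C (p ^ j * (p ^ (n - 1) * d)) = f j" if "j < n" for j
    using V_nth[of j "p ^ (n - 1) * d"] V_nth[of j a] V[of 0] that ad assms by (simp add: f_def)
  have "f ` {..<n} \<subseteq> {1..n - 1}"
  proof -
    have "1 \<le> p ^ j * a" for j using ad assms by (simp add: Suc_le_eq)
    then show ?thesis using C unfolding is_coloring_def f_def by blast
  qed
  then have "card (f ` {..<n}) < card {..<n}"
    using card_mono[of "{1..n - 1}" "f ` {..<n}"] assms(2) by simp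
  then have "\<not> inj_on f {..<n}" by (rule pigeonhole)
  then obtain u v where uv: "u < v" "v < n" "f u = f v"
    unfolding inj_on_def by (metis lessThan_iff linorder_neqE_nat)
  \<comment> \<open>Chosen so that \<open>k - 1 + v = n - 1 + u\<close>: in the equation,
    \<open>a\<close> then carries the same power of \<open>p\<close> on both sides.\<close>
  define k where "k = n - (v - u)"
  have k: "1 \<le> k" "k < n" "k - 1 + v = n - 1 + u" using uv by (auto simp: k_def)
  \<comment> \<open>The total coefficient of the variables other than \<open>x k\<close> and
    \<open>x n\<close>, which share one value; \<open>m * d\<close> in \<open>x n\<close> balances
    them.\<close>
  define m where "m = (\<Sum>i\<in>{1..n-1} - {k}. p ^ (i - 1))"
  have mL: "m \<le> L" unfolding m_def L_def by (rule sum_mono2) auto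
  define x where "x i = (if i = n then p ^ u * (a + m * d) else if i = k then p ^ v * a
      else p ^ u * (p ^ (n - 1) * d))" for i
  have col: "C (x i) = f u" for i
    using colA[OF mL, of u] colA[of 0 v] colD[of u] uv by (auto simp: x_def)
  have pos: "x i \<ge> 1" for i using ad assms by (simp add: x_def Suc_le_eq)
  have "(\<Sum>i=1..n-1. p ^ (i - 1) * x i)
      = p ^ (k - 1) * x k + (\<Sum>i\<in>{1..n-1} - {k}. p ^ (i - 1) * x i)"
    using k by (intro sum.remove) auto
  also have "(\<Sum>i\<in>{1..n-1} - {k}. p ^ (i - 1) * x i)
      = (\<Sum>i\<in>{1..n-1} - {k}. p ^ (i - 1) * (p ^ u * (p ^ (n - 1) * d)))"
    using assms(2) by (intro sum.cong) (auto simp: x_def)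
  also have "\<dots> = m * (p ^ u * (p ^ (n - 1) * d))"
    by (simp add: m_def sum_distrib_right)
  also have "p ^ (k - 1) * x k = p ^ (k - 1 + v) * a"
    using k(2) unfolding x_def power_add by simp
  also have "p ^ (k - 1 + v) * a + m * (p ^ u * (p ^ (n - 1) * d)) = p ^ (n - 1) * x n"
    unfolding k(3) by (simp add: x_def power_add algebra_simps)
  finally have eq: "(\<Sum>i=1..n-1. p ^ (i - 1) * x i) = p ^ (n - 1) * x n" .
  have "{1..n} = insert n {1..n-1}" using assms(2) by auto
  then have "(\<Sum>i=1..n. power_coeff p n i * int (x i))
      = power_coeff p n n * int (x n) + (\<Sum>i=1..n-1. power_coeff p n i * int (x i))"
    using assms(2) by simp
  also have "(\<Sum>i=1..n-1. power_coeff p n i * int (x i)) = int (\<Sum>i=1..n-1. p ^ (i - 1) * x i)"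
    unfolding of_nat_sum using assms(2) by (intro sum.cong) (auto simp: power_coeff_def)
  also have "power_coeff p n n * int (x n) + \<dots> = 0"
    unfolding eq by (simp add: power_coeff_def)
  finally show "\<exists>x. is_solution n (power_coeff p n) x \<and> monochromatic n C x"
    using pos col by (auto simp: is_solution_def monochromatic_def intro!: exI[of _ x])
qed

section \<open>Failure for \<open>n\<close> colours\<close>

lemma not_regular_power_coeff:
  fixes p n :: nat
  assumes "prime p" and "n \<ge> 1"
  shows "\<not> regular n n (power_coeff p n)"
proof
  assume reg: "regular n n (power_coeff p n)"
  define C where "C x = Suc (multiplicity p x mod n)" for x
  have "is_coloring n C"
    using assms(2) by (auto simp: is_coloring_def C_def Suc_le_eq)
  then obtain x where sol: "is_solution n (power_coeff p n) x" and mono: "monochromatic n C x"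
    using reg unfolding regular_def by blast
  \<comment> \<open>The \<open>p\<close>-adic valuation of the \<open>i\<close>-th term.\<close>
  define w where "w i = i - 1 + multiplicity p (x i)" for i
  \<comment> \<open>With equal colours, \<open>w i = w j\<close> makes \<open>i - 1\<close> and
    \<open>j - 1\<close> congruent modulo \<open>n\<close>, and both are below
    \<open>n\<close>.\<close>
  have inj: "i = j" if "i \<in> {1..n}" "j \<in> {1..n}" "w i = w j" for i j
  proof -
    have "multiplicity p (x i) mod n = multiplicity p (x j) mod n"
      using mono that unfolding monochromatic_def C_def by blast
    then have "int (multiplicity p (x i)) mod int n = int (multiplicity p (x j)) mod int n"
      by (metis zmod_int)
    then have "int n dvd int (multiplicity p (x j)) - int (multiplicity p (x i))"
      by (metis mod_eq_dvd_iff)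
    moreover have "int (multiplicity p (x j)) - int (multiplicity p (x i)) = int (i - 1) - int (j - 1)"
      using \<open>w i = w j\<close> unfolding w_def by linarith
    ultimately have "int (i - 1) mod int n = int (j - 1) mod int n"
      by (simp only: mod_eq_dvd_iff)
    then show ?thesis using that by auto
  qed
  have "\<exists>i\<in>{1..n}. \<forall>j\<in>{1..n}. w i \<le> w j"
    using assms(2) ex_min_if_finite[of "w ` {1..n}"] by (fastforce simp: not_less)
  then obtain i where i: "i \<in> {1..n}" "\<And>j. j \<in> {1..n} \<Longrightarrow> w i \<le> w j" by blast
  \<comment> \<open>Absolute values hide the sign of the last coefficient, so divisibility can be
    treated in the naturals.\<close>
  have coeff: "\<bar>power_coeff p n j * int (x j)\<bar> = int (p ^ (j - 1) * x j)" for j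
    by (simp add: power_coeff_def abs_mult)
  have dvd: "int (p ^ Suc (w i)) dvd power_coeff p n j * int (x j)"
    if "j \<in> {1..n} - {i}" for j
  proof -
    have "Suc (w i) \<le> w j" using i inj[OF i(1)] that by (metis Diff_iff Suc_leI le_neq_implies_less singletonI)
    then have "p ^ Suc (w i) dvd p ^ w j" by (rule le_imp_power_dvd)
    also have "p ^ w j dvd p ^ (j - 1) * x j"
      unfolding w_def power_add by (intro mult_dvd_mono dvd_refl multiplicity_dvd)
    finally have "int (p ^ Suc (w i)) dvd \<bar>power_coeff p n j * int (x j)\<bar>"
      unfolding coeff by (simp only: int_dvd_int_iff)
    then show ?thesis by simp
  qed
  have "(\<Sum>j=1..n. power_coeff p n j * int (x j)) = power_coeff p n i * int (x i)
      + (\<Sum>j\<in>{1..n} - {i}. power_coeff p n j * int (x j))"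
    using i(1) by (intro sum.remove) auto
  moreover have "int (p ^ Suc (w i)) dvd (\<Sum>j\<in>{1..n} - {i}. power_coeff p n j * int (x j))"
    by (rule dvd_sum) (rule dvd)
  \<comment> \<open>The total is 0, so the term of least valuation inherits the divisibility of the
    others.\<close>
  ultimately have "int (p ^ Suc (w i)) dvd power_coeff p n i * int (x i)"
    using sol unfolding is_solution_def by (metis dvd_add_left_iff dvd_0_right)
  then have "int (p ^ Suc (w i)) dvd \<bar>power_coeff p n i * int (x i)\<bar>" by simp
  then have "p ^ Suc (w i) dvd p ^ (i - 1) * x i"
    unfolding coeff by (simp only: int_dvd_int_iff)
  then have "p ^ (i - 1) * p ^ Suc (multiplicity p (x i)) dvd p ^ (i - 1) * x i"
    by (simp add: w_def power_add mult_ac)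
  then have "p ^ Suc (multiplicity p (x i)) dvd x i"
    using prime_gt_0_nat[OF assms(1)] by simp
  moreover have "x i \<noteq> 0" using sol i(1) unfolding is_solution_def by fastforce
  ultimately show False
    using multiplicity_geI[of "x i" p "Suc (multiplicity p (x i))"] prime_gt_1_nat[OF assms(1)]
    by auto
qed

theorem theorem3p3:
  fixes p n :: nat
  assumes "prime p" and "n \<ge> 2"
  shows "regular (n - 1) n (power_coeff p n) \<and> \<not> regular n n (power_coeff p n)"
  using regular_power_coeff[of p n] not_regular_power_coeff[of p n] prime_gt_0_nat[of p] assms
  by simp

end
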